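(* Let $Y$ be a Banach space admitting an equivalent norm with property $(\beta)$. Then $\sup_{h\ge 1}c_Y(T^\omega_h)=\infty$. In particular, if $Y$ is a Banach space with property $(\beta_p)$ with $p\in(1,\infty)$ and constant $\gamma:=\gamma(Y)>0$, then for every integer $h\ge 2$, $$c_Y(T^\omega_h)\ge 2\gamma^{\frac1p}\left(\log\left(\tfrac h2\right)\right)^{\frac1p}.$$
   Context: For metric spaces $X,Y$, a map $f\colon X\to Y$ is a bi-Lipschitz embedding if it is one-to-one and both $f$ and $f^{-1}$ (defined on $f(X)$) are Lipschitz; its distortion is $\mathrm{dist}(f)=\mathrm{Lip}(f)\cdot\mathrm{Lip}(f^{-1})$. $c_Y(X)$ denotes the infimum of $\mathrm{dist}(f)$ over all bi-Lipschitz embeddings $f\colon X\to Y$, and $c_Y(X)=\infty$ if there are none. For a positive integer $h$, $T^\omega_h$ is the unweighted complete countably branching rooted tree of height $h$ (its vertices are the finite sequences of positive integers of length at most $h$, the root being the empty sequence, and each sequence of length $<h$ is joined by an edge to each of its one-term extensions), equipped with the shortest path metric on its vertex set. Property $(\beta)$: let $B_Y$ be the closed unit ball of $Y$, and for a sequence put $\mathrm{sep}(\{y_i\}_{i=1}^\infty)=\inf\{\|y_n-y_m\|: n\ne m\}$. A Banach space $Y$ has property $(\beta)$ if for any $\varepsilon>0$ there is $\delta(\varepsilon)\in(0,1)$ such that for every $x\in B_Y$ and every sequence $(y_i)_{i=1}^\infty\subset B_Y$ with $\mathrm{sep}(\{y_i\})\ge\varepsilon$ there is $i_0$ with $\left\|\frac{x-y_{i_0}}2\right\|\le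 1-\delta(\varepsilon)$. The $(\beta)$-modulus is $$\bar\beta_Y(t)=1-\sup\left\{\inf_{i\ge1}\frac{\|x-y_i\|}{2}\colon x\in B_Y,\ (y_i)_{i=1}^\infty\subset B_Y,\ \mathrm{sep}(\{y_i\})\ge t\right\},$$ defined on an interval $[0,a]$ (those $t$ for which such sequences exist), where $a\in[1,2]$ depends on $Y$. $Y$ has property $(\beta_p)$ with constant $\gamma\in(0,\infty)$ if $\bar\beta_Y(t)\ge\gamma t^p$ for all $t\in[0,a]$. $\log$ denotes the natural logarithm. *)

theory Defs
  imports "HOL-Analysis.Analysis"
begin

section \<open>Distortion of embeddings between metric spaces\<close>

definition Lip_const :: "'a metric \<Rightarrow> 'b metric \<Rightarrow> ('a \<Rightarrow> 'b) \<Rightarrow> real" where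
  "Lip_const m1 m2 f =
     Inf {L. 0 \<le> L \<and> (\<forall>x\<in>mspace m1. \<forall>y\<in>mspace m1. mdist m2 (f x) (f y) \<le> L * mdist m1 x y)}"

definition bilipschitz_embedding :: "'a metric \<Rightarrow> 'b metric \<Rightarrow> ('a \<Rightarrow> 'b) \<Rightarrow> bool" where
  "bilipschitz_embedding m1 m2 f \<longleftrightarrow>
     inj_on f (mspace m1) \<and>
     Lipschitz_continuous_map m1 m2 f \<and>
     Lipschitz_continuous_map (submetric m2 (f ` mspace m1)) m1 (inv_into (mspace m1) f)"

definition distortion :: "'a metric \<Rightarrow> 'b metric \<Rightarrow> ('a \<Rightarrow> 'b) \<Rightarrow> real" where
  "distortion m1 m2 f =
     Lip_const m1 m2 f * Lip_const (submetric m2 (f ` mspace m1)) m1 (inv_into (mspace m1) f)"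

text \<open>Here \<open>least_distortion mY mX\<close> is $c_Y(X)$; it is \<open>\<infinity>\<close> when there is no embedding,
  since the infimum of the empty set in \<^typ>\<open>ereal\<close> is \<open>\<infinity>\<close>.\<close>

definition least_distortion :: "'b metric \<Rightarrow> 'a metric \<Rightarrow> ereal" where
  "least_distortion mY mX =
     (INF f \<in> {f. bilipschitz_embedding mX mY f}. ereal (distortion mX mY f))"


section \<open>The countably branching tree of height h\<close>

definition tree_vertices :: "nat \<Rightarrow> nat list set" where
  "tree_vertices h = {u. (\<forall>k\<in>set u. 1 \<le> k) \<and> length u \<le> h}"

definition tree_edges :: "nat \<Rightarrow> (nat list \<times> nat list) set" where
  "tree_edges h = {(u, v). u \<in> tree_vertices h \<and> v \<in> tree_vertices h \<and>
                           (\<exists>k. v = u @ [k] \<or> u = v @ [k])}"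

text \<open>A walk with \<open>n\<close> edges from \<open>u\<close> to \<open>v\<close> exists iff \<open>(u, v)\<close> lies in the \<open>n\<close>-th
  relational power of the (symmetric) edge relation.\<close>

definition tree_dist :: "nat \<Rightarrow> nat list \<Rightarrow> nat list \<Rightarrow> real" where
  "tree_dist h u v = real (LEAST n. (u, v) \<in> tree_edges h ^^ n)"

definition tree_metric :: "nat \<Rightarrow> nat list metric" where
  "tree_metric h = metric (tree_vertices h, tree_dist h)"

lemma sym_tree_edges: "sym (tree_edges h)"
  by (auto simp: sym_def tree_edges_def)

lemma tree_walk_sym: "(u, v) \<in> tree_edges h ^^ n \<Longrightarrow> (v, u) \<in> tree_edges h ^^ n"
proof (induction n arbitrary: v)
  case (Suc n)
  then obtain w where "(u, w) \<in> tree_edges h ^^ n" "(w, v) \<in> tree_edges h" by auto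
  then show ?case
    using Suc.IH sym_tree_edges[of h] by (meson relpow_Suc_I2 symD)
qed auto

lemma tree_walk_root: "u \<in> tree_vertices h \<Longrightarrow> ([], u) \<in> tree_edges h ^^ length u"
proof (induction u rule: rev_induct)
  case (snoc k u)
  then have "u \<in> tree_vertices h" by (auto simp: tree_vertices_def)
  moreover from this snoc.prems have "(u, u @ [k]) \<in> tree_edges h"
    by (auto simp: tree_edges_def)
  ultimately show ?case using snoc.IH by auto
qed auto

lemma tree_walk_exists:
  assumes "u \<in> tree_vertices h" "v \<in> tree_vertices h"
  shows "\<exists>n. (u, v) \<in> tree_edges h ^^ n"
  using relpow_trans[OF tree_walk_sym[OF tree_walk_root[OF assms(1)]] tree_walk_root[OF assms(2)]]
  by blast

lemma Metric_space_tree: "Metric_space (tree_vertices h) (tree_dist h)"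
proof
  show "0 \<le> tree_dist h u v" for u v
    by (simp add: tree_dist_def)
  have "(u, v) \<in> tree_edges h ^^ n \<longleftrightarrow> (v, u) \<in> tree_edges h ^^ n" for u v n
    using tree_walk_sym by blast
  then show "tree_dist h u v = tree_dist h v u" for u v
    unfolding tree_dist_def by presburger
  have walk: "(u, v) \<in> tree_edges h ^^ (LEAST n. (u, v) \<in> tree_edges h ^^ n)"
    if "u \<in> tree_vertices h" "v \<in> tree_vertices h" for u v
    using tree_walk_exists[OF that] by (rule LeastI_ex)
  show "tree_dist h u v = 0 \<longleftrightarrow> u = v"
    if "u \<in> tree_vertices h" "v \<in> tree_vertices h" for u v
  proof
    assume "tree_dist h u v = 0"
    with walk[OF that] show "u = v" by (simp add: tree_dist_def)
  next
    assume "u = v"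
    then have "(LEAST n. (u, v) \<in> tree_edges h ^^ n) = 0" by (intro Least_eq_0) auto
    then show "tree_dist h u v = 0" by (simp add: tree_dist_def)
  qed
  show "tree_dist h u w \<le> tree_dist h u v + tree_dist h v w"
    if "u \<in> tree_vertices h" "v \<in> tree_vertices h" "w \<in> tree_vertices h" for u v w
  proof -
    have "(LEAST n. (u, w) \<in> tree_edges h ^^ n)
        \<le> (LEAST n. (u, v) \<in> tree_edges h ^^ n) + (LEAST n. (v, w) \<in> tree_edges h ^^ n)"
      using relpow_trans[OF walk[OF that(1,2)] walk[OF that(2,3)]] by (rule Least_le)
    then show ?thesis unfolding tree_dist_def by linarith
  qed
qed

lemma mspace_tree_metric [simp]: "mspace (tree_metric h) = tree_vertices h"
  by (simp add: tree_metric_def Metric_space.mspace_metric Metric_space_tree)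

lemma mdist_tree_metric [simp]: "mdist (tree_metric h) = tree_dist h"
  by (simp add: tree_metric_def Metric_space.mdist_metric Metric_space_tree)


section \<open>Property (beta) and the (beta)-modulus\<close>

text \<open>Property (beta) is not invariant under renorming, so the notions below take the norm \<open>N\<close>
  on the underlying vector space as an argument; for the given norm of the space use \<open>N = norm\<close>.\<close>

definition equivalent_norm :: "('a::real_normed_vector \<Rightarrow> real) \<Rightarrow> bool" where
  "equivalent_norm N \<longleftrightarrow>
     (\<forall>x. N x = 0 \<longleftrightarrow> x = 0) \<and>
     (\<forall>x y. N (x + y) \<le> N x + N y) \<and>
     (\<forall>r x. N (r *\<^sub>R x) = \<bar>r\<bar> * N x) \<and>
     (\<exists>A>0. \<exists>B>0. \<forall>x. A * norm x \<le> N x \<and> N x \<le> B * norm x)"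

definition unit_ball :: "('a::real_vector \<Rightarrow> real) \<Rightarrow> 'a set" where
  "unit_ball N = {x. N x \<le> 1}"

definition sep :: "('a::real_vector \<Rightarrow> real) \<Rightarrow> (nat \<Rightarrow> 'a) \<Rightarrow> real" where
  "sep N y = Inf {N (y n - y m) |n m. n \<noteq> m}"

definition property_beta :: "('a::real_vector \<Rightarrow> real) \<Rightarrow> bool" where
  "property_beta N \<longleftrightarrow>
     (\<forall>\<epsilon>>0. \<exists>\<delta>. 0 < \<delta> \<and> \<delta> < 1 \<and>
        (\<forall>x\<in>unit_ball N. \<forall>y. range y \<subseteq> unit_ball N \<and> \<epsilon> \<le> sep N y \<longrightarrow>
           (\<exists>i. N ((1/2) *\<^sub>R (x - y i)) \<le> 1 - \<delta>)))"

text \<open>The parameters at which the modulus is defined: those \<open>t\<close> for which the family in its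
  supremum is nonempty. (The ball always contains the point \<open>x = 0\<close>.)\<close>

definition beta_domain :: "('a::real_vector \<Rightarrow> real) \<Rightarrow> real set" where
  "beta_domain N = {t. 0 \<le> t \<and> (\<exists>y. range y \<subseteq> unit_ball N \<and> t \<le> sep N y)}"

definition beta_modulus :: "('a::real_vector \<Rightarrow> real) \<Rightarrow> real \<Rightarrow> real" where
  "beta_modulus N t =
     1 - Sup {(INF i. N (x - y i) / 2) |x y.
                x \<in> unit_ball N \<and> range y \<subseteq> unit_ball N \<and> t \<le> sep N y}"

definition property_beta_p :: "('a::real_vector \<Rightarrow> real) \<Rightarrow> real \<Rightarrow> real \<Rightarrow> bool" where
  "property_beta_p N p \<gamma> \<longleftrightarrow>
     0 < \<gamma> \<and> (\<forall>t\<in>beta_domain N. \<gamma> * t powr p \<le> beta_modulus N t)"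

end

theory Submission
  imports Defs
begin

text \<open>The lower bound comes from a self-improvement argument. Let \<open>f\<close> embed the tree of height \<open>2h\<close>
  so that distances do not shrink and every edge has image of length at most \<open>D\<close>. Consider a vertex
  \<open>w\<close>, a child \<open>w b\<close> and the infinitely many children \<open>w b i\<close> of \<open>w b\<close>. Seen from \<open>f (w b)\<close>, the
  points \<open>f w\<close> and \<open>f (w b i)\<close> lie in the ball of radius \<open>D\<close>, and the latter are \<open>2\<close>-separated, so
  property (beta) produces some \<open>i\<close> for which \<open>f w\<close> and \<open>f (w b i)\<close> are at distance at most
  \<open>2 (D - c)\<close> with \<open>c > 0\<close>, instead of the trivial \<open>2 D\<close>. Keeping only one such grandchild \<open>w b i\<close>
  for every \<open>w\<close> and \<open>b\<close> leaves a copy of the tree of height \<open>h\<close> whose metric is doubled exactly;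
  after division by \<open>2\<close>, distances still do not shrink and edges now have length at most \<open>D - c\<close>
  (\<open>tree_embeds_halve\<close>). Starting from height \<open>2 ^ k\<close>, the edge bound drops \<open>k\<close> times and can never
  fall below \<open>1\<close>, whence \<open>1 + k c \<le> D\<close> (\<open>tree_embeds_pow2_bound\<close>), provided that the gain \<open>c\<close>
  is available at every radius between \<open>1\<close> and \<open>D\<close>.

  Under property (beta) such a \<open>c > 0\<close> exists for each \<open>D\<close>: a separation of \<open>2\<close> at radius \<open>s \<le> D\<close>
  is a relative separation of at least \<open>2 / D\<close>. Thus no finite \<open>D\<close> serves all heights. An
  equivalent norm changes \<open>D\<close> by a constant factor only. Under property $(\beta_p)$ with
  constant \<open>\<gamma>\<close>, any \<open>\<gamma>' < \<gamma>\<close> gives the gain \<open>\<gamma>' (2 / s) ^ p s\<close> at radius \<open>s\<close>. Since \<open>p > 1\<close>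
  this decreases in \<open>s\<close>, so its value at \<open>s = D\<close> can be used throughout, and
  \<open>k \<gamma> 2 ^ p \<le> D ^ p\<close> follows as \<open>\<gamma>'\<close> tends to \<open>\<gamma>\<close>. For the largest \<open>k\<close> with \<open>2 ^ k \<le> h\<close> one has
  \<open>k \<ge> log 2 (h / 2) \<ge> ln (h / 2)\<close>, which is the stated bound.\<close>

section \<open>An explicit formula for the tree distance\<close>

text \<open>The length of the path that climbs from \<open>u\<close> to the longest common prefix of \<open>u\<close> and \<open>v\<close> and
  descends to \<open>v\<close>. Unlike the graph distance it does not mention the height, and it can be computed
  by recursion.\<close>

fun prefix_dist :: "nat list \<Rightarrow> nat list \<Rightarrow> nat" where
  "prefix_dist [] v = length v"
| "prefix_dist (a # u) [] = Suc (length u)"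
| "prefix_dist (a # u) (b # v) =
     (if a = b then prefix_dist u v else length u + length v + 2)"

lemma prefix_dist_same [simp]: "prefix_dist u u = 0"
  by (induction u) auto

lemma prefix_dist_append_left [simp]: "prefix_dist (w @ u) (w @ v) = prefix_dist u v"
  by (induction w) auto

lemma prefix_dist_snoc [simp]: "prefix_dist u (u @ [k]) = 1"
  by (induction u) auto

text \<open>Crossing an edge changes \<open>prefix_dist u\<close> by at most one in either direction, so a walk of \<open>n\<close>
  edges starting at \<open>u\<close> ends at most \<open>n\<close> away. Only this lower bound on the graph distance matters
  below, together with the fact that adjacent vertices are at distance at most one.\<close>

lemma prefix_dist_snoc_le: "prefix_dist u (w @ [k]) \<le> Suc (prefix_dist u w)"
proof (induction u w rule: prefix_dist.induct)
  case (2 a u) then show ?case by (cases u) auto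
qed auto

lemma prefix_dist_le_snoc: "prefix_dist u w \<le> Suc (prefix_dist u (w @ [k]))"
proof (induction u w rule: prefix_dist.induct)
  case (2 a u) then show ?case by (cases u) auto
qed auto

lemma prefix_dist_le_walk: "(u, v) \<in> tree_edges h ^^ n \<Longrightarrow> prefix_dist u v \<le> n"
proof (induction n arbitrary: v)
  case (Suc n)
  then obtain w where w: "(u, w) \<in> tree_edges h ^^ n" "(w, v) \<in> tree_edges h" by auto
  then obtain k where "v = w @ [k] \<or> w = v @ [k]" by (auto simp: tree_edges_def)
  then have "prefix_dist u v \<le> Suc (prefix_dist u w)"
    using prefix_dist_snoc_le prefix_dist_le_snoc by blast
  with Suc.IH[OF w(1)] show ?case by linarith
qed auto

lemma prefix_dist_le_tree_dist:
  assumes "u \<in> tree_vertices h" "v \<in> tree_vertices h"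
  shows "real (prefix_dist u v) \<le> tree_dist h u v"
  using prefix_dist_le_walk[OF LeastI_ex[OF tree_walk_exists[OF assms]]]
  by (simp add: tree_dist_def)

lemma tree_dist_snoc_le:
  assumes "u @ [k] \<in> tree_vertices h"
  shows "tree_dist h u (u @ [k]) \<le> 1"
proof -
  have "(u, u @ [k]) \<in> tree_edges h ^^ 1"
    using assms by (auto simp: tree_edges_def tree_vertices_def)
  then have "(LEAST n. (u, u @ [k]) \<in> tree_edges h ^^ n) \<le> 1" by (rule Least_le)
  then show ?thesis by (simp add: tree_dist_def)
qed


section \<open>Halving the height of an embedded tree\<close>

text \<open>An embedding is normalised so that distances do not shrink; then \<open>D\<close> bounds the
  distortion. The upper estimate is required on edges only because in a path metric it propagates
  to all pairs by the triangle inequality.\<close>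

definition tree_embeds :: "('a::real_vector \<Rightarrow> real) \<Rightarrow> nat \<Rightarrow> real \<Rightarrow> bool" where
  "tree_embeds N h D \<longleftrightarrow> (\<exists>f.
     (\<forall>u\<in>tree_vertices h. \<forall>v\<in>tree_vertices h. real (prefix_dist u v) \<le> N (f u - f v)) \<and>
     (\<forall>u k. u @ [k] \<in> tree_vertices h \<longrightarrow> N (f u - f (u @ [k])) \<le> D))"

text \<open>A quantitative form of property (beta) on the ball of radius \<open>s\<close>, applied to forks: the origin
  is the image of a branching vertex, \<open>x\<close> that of its parent and the \<open>y i\<close> those of its
  children, which are \<open>2\<close>-separated because siblings are at distance two. The number \<open>c\<close> is the
  gain over the triangle inequality.\<close>

definition fork_contracting :: "('a::real_vector \<Rightarrow> real) \<Rightarrow> real \<Rightarrow> real \<Rightarrow> bool" where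
  "fork_contracting N s c \<longleftrightarrow>
     (\<forall>x y. N x \<le> s \<and> (\<forall>i::nat. N (y i) \<le> s) \<and> (\<forall>m n. m \<noteq> n \<longrightarrow> 2 \<le> N (y m - y n)) \<longrightarrow>
        (\<exists>i. N (x - y i) \<le> 2 * (s - c)))"

lemma tree_embeds_mono:
  assumes "tree_embeds N h D" "h' \<le> h" "D \<le> D'"
  shows "tree_embeds N h' D'"
proof -
  have "tree_vertices h' \<subseteq> tree_vertices h"
    using assms(2) by (auto simp: tree_vertices_def)
  moreover obtain f where
    "\<And>u v. u \<in> tree_vertices h \<Longrightarrow> v \<in> tree_vertices h \<Longrightarrow> real (prefix_dist u v) \<le> N (f u - f v)"
    "\<And>u k. u @ [k] \<in> tree_vertices h \<Longrightarrow> N (f u - f (u @ [k])) \<le> D"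
    using assms(1) unfolding tree_embeds_def by blast
  ultimately show ?thesis
    unfolding tree_embeds_def using \<open>D \<le> D'\<close>
    by (intro exI[of _ f]) (blast intro: order_trans)
qed

lemma tree_embeds_ge_1:
  assumes "tree_embeds N h D" "1 \<le> h"
  shows "1 \<le> D"
proof -
  have v: "[] \<in> tree_vertices h" "[1] \<in> tree_vertices h"
    using assms(2) by (auto simp: tree_vertices_def)
  from assms(1) obtain f where
    "\<forall>u\<in>tree_vertices h. \<forall>v\<in>tree_vertices h. real (prefix_dist u v) \<le> N (f u - f v)"
    "\<forall>u k. u @ [k] \<in> tree_vertices h \<longrightarrow> N (f u - f (u @ [k])) \<le> D"
    unfolding tree_embeds_def by blast
  then have "real (prefix_dist [] [1]) \<le> N (f [] - f [1])" "N (f [] - f ([] @ [1])) \<le> D"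
    using v by (blast, metis append_Nil)
  then show ?thesis by simp
qed

text \<open>The copy of the tree inside a tree of twice the height: the letters of a word are kept, and
  after each letter \<open>b\<close> the letter that \<open>i\<close> selects at the vertex reached so far is inserted. The
  argument \<open>p\<close> is the part of the image that has been produced already.\<close>

fun interleave :: "(nat list \<Rightarrow> nat \<Rightarrow> nat) \<Rightarrow> nat list \<Rightarrow> nat list \<Rightarrow> nat list" where
  "interleave i p [] = []"
| "interleave i p (b # u) = b # i p b # interleave i (p @ [b, i p b]) u"

lemma length_interleave [simp]: "length (interleave i p u) = 2 * length u"
  by (induction u arbitrary: p) auto

lemma interleave_snoc:
  "interleave i p (u @ [b]) = interleave i p u @ [b, i (p @ interleave i p u) b]"
  by (induction u arbitrary: p) auto

text \<open>An inserted letter is determined by the word before it, so it lengthens a common prefix and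
  never causes two words to branch. All path lengths therefore double exactly.\<close>

lemma prefix_dist_interleave:
  "prefix_dist (interleave i p u) (interleave i p v) = 2 * prefix_dist u v"
  by (induction u v arbitrary: p rule: prefix_dist.induct) auto

lemma interleave_in_tree_vertices:
  assumes "u \<in> tree_vertices h" "\<And>p b. 1 \<le> i p b"
  shows "interleave i p u \<in> tree_vertices (2 * h)"
proof -
  have "(\<forall>k\<in>set u. 1 \<le> k) \<Longrightarrow> (\<forall>k\<in>set (interleave i p u). 1 \<le> k)"
  proof (induction u arbitrary: p)
    case (Cons b u)
    then have "\<forall>k\<in>set (interleave i (p @ [b, i p b]) u). 1 \<le> k" by simp
    then show ?case using Cons.prems assms(2)[of p b] by simp
  qed simp
  with assms(1) show ?thesis by (simp add: tree_vertices_def)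
qed

text \<open>The self-improvement step: the grandchild selected by \<open>i\<close> at \<open>w\<close> and \<open>b\<close> is one that fork
  contraction brings close to \<open>w\<close>.\<close>

lemma tree_embeds_halve:
  fixes N :: "'a::real_vector \<Rightarrow> real"
  assumes hom: "\<And>r x. N (r *\<^sub>R x) = \<bar>r\<bar> * N x"
    and emb: "tree_embeds N (2 * h) D"
    and fork: "fork_contracting N D c"
  shows "tree_embeds N h (D - c)"
proof -
  from emb obtain f where
    lower: "\<And>u v. u \<in> tree_vertices (2*h) \<Longrightarrow> v \<in> tree_vertices (2*h) \<Longrightarrow>
                real (prefix_dist u v) \<le> N (f u - f v)"
    and upper: "\<And>u k. u @ [k] \<in> tree_vertices (2*h) \<Longrightarrow> N (f u - f (u @ [k])) \<le> D"
    unfolding tree_embeds_def by blast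
  have sym: "N (a - b) = N (b - a)" for a b
    using hom[of "-1" "a - b"] by simp
  \<comment> \<open>Outside the tree any positive letter will do; positivity everywhere makes \<open>i\<close> map into the
    tree without side conditions.\<close>
  have "\<exists>j\<ge>1. w @ [b, 1] \<in> tree_vertices (2*h) \<longrightarrow> N (f w - f (w @ [b, j])) \<le> 2 * (D - c)"
    for w b
  proof (cases "w @ [b, 1] \<in> tree_vertices (2*h)")
    case True
    then have vert: "w @ [b] \<in> tree_vertices (2*h)" "w @ [b, Suc j] \<in> tree_vertices (2*h)" for j
      by (auto simp: tree_vertices_def)
    \<comment> \<open>Sequences are indexed from \<open>0\<close>, letters from \<open>1\<close>.\<close>
    define x y where "x = f w - f (w @ [b])" and "y j = f (w @ [b, Suc j]) - f (w @ [b])" for j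
    have "N x \<le> D"
      unfolding x_def by (rule upper[OF vert(1)])
    moreover have "N (y j) \<le> D" for j
      using upper[of "w @ [b]" "Suc j"] vert(2)[of j] sym unfolding y_def by simp
    moreover have "2 \<le> N (y m - y n)" if "m \<noteq> n" for m n
      using lower[OF vert(2) vert(2), of m n] that unfolding y_def by simp
    ultimately obtain j where "N (x - y j) \<le> 2 * (D - c)"
      using fork unfolding fork_contracting_def by metis
    then show ?thesis
      by (intro exI[of _ "Suc j"]) (simp add: x_def y_def)
  qed auto
  then obtain i where i1: "\<And>w b. 1 \<le> i w b"
    and i: "\<And>w b. w @ [b, 1] \<in> tree_vertices (2*h) \<Longrightarrow>
              N (f w - f (w @ [b, i w b])) \<le> 2 * (D - c)"
    by metis
  define e where "e = interleave i []"
  define g where "g u = (1/2) *\<^sub>R f (e u)" for u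
  have Ng: "N (g u - g v) = N (f (e u) - f (e v)) / 2" for u v
    unfolding g_def using hom[of "1/2"] by (simp flip: scaleR_diff_right)
  have e: "e u \<in> tree_vertices (2*h)" if "u \<in> tree_vertices h" for u
    unfolding e_def by (rule interleave_in_tree_vertices[OF that]) (rule i1)
  have "real (prefix_dist u v) \<le> N (g u - g v)"
    if "u \<in> tree_vertices h" "v \<in> tree_vertices h" for u v
    using lower[OF e[OF that(1)] e[OF that(2)]]
    by (simp add: Ng e_def prefix_dist_interleave)
  moreover have "N (g u - g (u @ [k])) \<le> D - c" if "u @ [k] \<in> tree_vertices h" for u k
  proof -
    have "e u @ [k, i (e u) k] \<in> tree_vertices (2*h)"
      using e[OF that] by (simp add: interleave_snoc e_def)
    then have "e u @ [k, 1] \<in> tree_vertices (2*h)"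
      by (auto simp: tree_vertices_def)
    from i[OF this] show ?thesis
      by (simp add: Ng) (simp add: e_def interleave_snoc)
  qed
  ultimately show ?thesis unfolding tree_embeds_def by blast
qed

text \<open>Each halving lowers the edge bound by \<open>c\<close>; after \<open>k\<close> of them a single edge remains, whose
  image has length at least one. The gain is needed at all radii in \<open>[1, D]\<close> because the edge bound
  moves through this interval.\<close>

lemma tree_embeds_pow2_bound:
  fixes N :: "'a::real_vector \<Rightarrow> real"
  assumes hom: "\<And>r x. N (r *\<^sub>R x) = \<bar>r\<bar> * N x"
    and emb: "tree_embeds N (2 ^ k) D"
    and "0 \<le> c"
    and fork: "\<And>s. 1 \<le> s \<Longrightarrow> s \<le> D \<Longrightarrow> fork_contracting N s c"
  shows "1 + real k * c \<le> D"
  using emb fork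
proof (induction k arbitrary: D)
  case 0
  then show ?case using tree_embeds_ge_1[of N 1 D] by simp
next
  case (Suc k)
  have "1 \<le> D" using tree_embeds_ge_1[OF Suc.prems(1)] by simp
  then have "tree_embeds N (2 ^ k) (D - c)"
    using tree_embeds_halve[OF hom _ Suc.prems(2)[of D]] Suc.prems(1) by simp
  then have "1 + real k * c \<le> D - c"
    using Suc.IH Suc.prems(2) \<open>0 \<le> c\<close> by simp
  then show ?case by (simp add: algebra_simps)
qed


section \<open>Fork contraction from property (beta)\<close>

text \<open>Rescaling by \<open>1 / s\<close> turns \<open>2\<close>-separated points of the ball of radius \<open>s\<close> into
  \<open>2 / s\<close>-separated points of the unit ball.\<close>

lemma fork_contractingI:
  fixes N :: "'a::real_vector \<Rightarrow> real"
  assumes hom: "\<And>r x. N (r *\<^sub>R x) = \<bar>r\<bar> * N x"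
    and "0 < s"
    and ball: "\<And>x y. x \<in> unit_ball N \<Longrightarrow> range y \<subseteq> unit_ball N \<Longrightarrow> 2 / s \<le> sep N y \<Longrightarrow>
                 \<exists>i. N (x - y i) \<le> 2 * (1 - c / s)"
  shows "fork_contracting N s c"
  unfolding fork_contracting_def
proof (intro allI impI)
  fix x :: 'a and y :: "nat \<Rightarrow> 'a"
  assume a: "N x \<le> s \<and> (\<forall>i. N (y i) \<le> s) \<and> (\<forall>m n. m \<noteq> n \<longrightarrow> 2 \<le> N (y m - y n))"
  define x' y' where "x' = (1/s) *\<^sub>R x" and "y' i = (1/s) *\<^sub>R y i" for i
  have N: "N ((1/s) *\<^sub>R z) = N z / s" for z
    using hom[of "1/s" z] \<open>0 < s\<close> by simp
  have diff: "N (y' m - y' n) = N (y m - y n) / s" "N (x' - y' n) = N (x - y n) / s" for m n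
    unfolding x'_def y'_def N[symmetric] by (simp_all add: scaleR_diff_right)
  have "2 / s \<le> sep N y'"
    unfolding sep_def
  proof (rule cInf_greatest)
    show "{N (y' n - y' m) |n m. n \<noteq> m} \<noteq> {}"
      using zero_neq_one by blast
  qed (use a \<open>0 < s\<close> diff in \<open>auto simp: divide_right_mono\<close>)
  moreover have "x' \<in> unit_ball N" "range y' \<subseteq> unit_ball N"
    using a \<open>0 < s\<close> by (auto simp: unit_ball_def x'_def y'_def N)
  ultimately obtain i where "N (x' - y' i) \<le> 2 * (1 - c / s)"
    using ball by blast
  then have "N (x - y i) \<le> 2 * (s - c)"
    using \<open>0 < s\<close> by (simp add: diff field_simps)
  then show "\<exists>i. N (x - y i) \<le> 2 * (s - c)" ..
qed

text \<open>The smallest relative separation that occurs for radii up to \<open>D\<close> is \<open>2 / D\<close>, so the \<open>\<delta>\<close>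
  belonging to it serves all of them. In absolute terms the gain at radius \<open>s\<close> is \<open>s * \<delta>\<close>,
  which is at least \<open>\<delta>\<close>.\<close>

lemma property_beta_fork_contracting:
  fixes N :: "'a::real_vector \<Rightarrow> real"
  assumes hom: "\<And>r x. N (r *\<^sub>R x) = \<bar>r\<bar> * N x"
    and beta: "property_beta N" and "0 < D"
  obtains c where "0 < c" "\<And>s. 1 \<le> s \<Longrightarrow> s \<le> D \<Longrightarrow> fork_contracting N s c"
proof -
  have "0 < 2 / D" using \<open>0 < D\<close> by simp
  then obtain \<delta> where "0 < \<delta>"
    and \<delta>: "\<And>x y. x \<in> unit_ball N \<Longrightarrow> range y \<subseteq> unit_ball N \<Longrightarrow> 2 / D \<le> sep N y \<Longrightarrow>
              \<exists>i. N ((1/2) *\<^sub>R (x - y i)) \<le> 1 - \<delta>"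
    using beta unfolding property_beta_def by meson
  have "fork_contracting N s \<delta>" if s: "1 \<le> s" "s \<le> D" for s
  proof (rule fork_contractingI[OF hom])
    show "0 < s" using s by simp
    fix x :: 'a and y :: "nat \<Rightarrow> 'a"
    assume xy: "x \<in> unit_ball N" "range y \<subseteq> unit_ball N" "2 / s \<le> sep N y"
    have "2 / D \<le> 2 / s" using s by (simp add: frac_le)
    with xy(3) have "2 / D \<le> sep N y" by linarith
    from \<delta>[OF xy(1,2) this] obtain i where "N ((1/2) *\<^sub>R (x - y i)) \<le> 1 - \<delta>" ..
    then have "N (x - y i) \<le> 2 * (1 - \<delta>)"
      using hom[of "1/2"] by simp
    also have "\<dots> \<le> 2 * (1 - \<delta> / s)"
      using s \<open>0 < \<delta>\<close> by (simp add: field_simps)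
    finally show "\<exists>i. N (x - y i) \<le> 2 * (1 - \<delta> / s)" ..
  qed
  with \<open>0 < \<delta>\<close> show thesis by (rule that)
qed

text \<open>The supremum in the modulus bounds the infimum over \<open>i\<close>, which need not be attained; the strict
  inequality on \<open>d\<close> leaves the room needed to pick an actual index.\<close>

lemma beta_modulus_less_imp_close_point:
  fixes x :: "'a::real_normed_vector"
  assumes x: "x \<in> unit_ball norm" and y: "range y \<subseteq> unit_ball norm" and t: "t \<le> sep norm y"
    and d: "d < beta_modulus (norm :: 'a \<Rightarrow> real) t"
  obtains i where "norm (x - y i) < 2 * (1 - d)"
proof -
  define S where "S = {(INF i. norm (x - y i) / 2) |(x::'a) y.
                x \<in> unit_ball norm \<and> range y \<subseteq> unit_ball norm \<and> t \<le> sep norm y}"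
  have bb: "bdd_below (range (\<lambda>i. norm (x - y i) / 2))" for x :: 'a and y :: "nat \<Rightarrow> 'a"
    by (rule bdd_belowI[of _ 0]) auto
  have "bdd_above S"
  proof (rule bdd_aboveI[of _ 1])
    fix z assume "z \<in> S"
    then obtain x :: 'a and y :: "nat \<Rightarrow> 'a" where z: "z = (INF i. norm (x - y i) / 2)"
      and xy: "x \<in> unit_ball norm" "range y \<subseteq> unit_ball norm"
      unfolding S_def by blast
    have "z \<le> norm (x - y 0) / 2"
      unfolding z by (rule cINF_lower[OF bb]) simp
    moreover have "norm x \<le> 1" "norm (y 0) \<le> 1"
      using xy by (auto simp: unit_ball_def)
    moreover have "norm (x - y 0) \<le> norm x + norm (y 0)"
      by (rule norm_triangle_ineq4)
    ultimately show "z \<le> 1" by linarith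
  qed
  moreover have "(INF i. norm (x - y i) / 2) \<in> S"
    unfolding S_def using x y t by blast
  ultimately have "(INF i. norm (x - y i) / 2) \<le> Sup S"
    by (rule cSup_upper[rotated])
  also have "Sup S = 1 - beta_modulus (norm :: 'a \<Rightarrow> real) t"
    by (simp add: beta_modulus_def S_def)
  also have "\<dots> < 1 - d" using d by simp
  finally obtain i where "norm (x - y i) / 2 < 1 - d"
    using cINF_less_iff[OF _ bb] by auto
  then show thesis by (intro that[of i]) simp
qed

text \<open>At radius \<open>s\<close> the modulus gives the gain \<open>\<gamma>' * (2 / s) powr p * s\<close>, that is
  \<open>\<gamma>' * 2 powr p * s powr (1 - p)\<close>. As \<open>1 < p\<close>, this is smallest at \<open>s = D\<close>.\<close>

lemma property_beta_p_fork_contracting: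
  assumes beta: "property_beta_p (norm :: 'a::real_normed_vector \<Rightarrow> real) p \<gamma>"
    and "\<gamma>' < \<gamma>" "0 \<le> \<gamma>'" "1 < p" and s: "1 \<le> s" "s \<le> D"
  shows "fork_contracting (norm :: 'a \<Rightarrow> real) s (\<gamma>' * 2 powr p * D powr (1 - p))"
proof (rule fork_contractingI)
  show "0 < s" using s by simp
  fix x :: 'a and y :: "nat \<Rightarrow> 'a"
  assume xy: "x \<in> unit_ball norm" "range y \<subseteq> unit_ball norm" "2 / s \<le> sep norm y"
  then have "2 / s \<in> beta_domain (norm :: 'a \<Rightarrow> real)"
    using s by (auto simp: beta_domain_def)
  then have "\<gamma> * (2 / s) powr p \<le> beta_modulus (norm :: 'a \<Rightarrow> real) (2 / s)"
    using beta by (auto simp: property_beta_p_def)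
  moreover have "\<gamma>' * (2 / s) powr p < \<gamma> * (2 / s) powr p"
    using \<open>\<gamma>' < \<gamma>\<close> s by simp
  ultimately obtain i where i: "norm (x - y i) < 2 * (1 - \<gamma>' * (2 / s) powr p)"
    using beta_modulus_less_imp_close_point[OF xy] by (meson less_le_trans)
  have "\<gamma>' * 2 powr p * D powr (1 - p) \<le> \<gamma>' * 2 powr p * s powr (1 - p)"
    using s \<open>1 < p\<close> \<open>0 \<le> \<gamma>'\<close> by (intro mult_left_mono powr_mono2') auto
  also have "\<dots> = \<gamma>' * (2 / s) powr p * s"
    using s by (simp add: powr_divide powr_diff)
  finally have "\<gamma>' * 2 powr p * D powr (1 - p) / s \<le> \<gamma>' * (2 / s) powr p"
    using s by (simp add: pos_divide_le_eq)
  then have "2 * (1 - \<gamma>' * (2 / s) powr p) \<le> 2 * (1 - \<gamma>' * 2 powr p * D powr (1 - p) / s)"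
    by simp
  with i have "norm (x - y i) \<le> 2 * (1 - \<gamma>' * 2 powr p * D powr (1 - p) / s)"
    by (meson less_imp_le order_trans)
  then show "\<exists>i. norm (x - y i) \<le> 2 * (1 - \<gamma>' * 2 powr p * D powr (1 - p) / s)" ..
qed simp


section \<open>Distortion\<close>

text \<open>The infimum defining the Lipschitz constant is itself a Lipschitz constant: at distinct points
  every admissible \<open>L\<close> dominates the difference quotient, hence so does the infimum.\<close>

lemma Lip_const_bound:
  assumes "Lipschitz_continuous_map m1 m2 f"
  shows "0 \<le> Lip_const m1 m2 f"
    and "\<And>x y. x \<in> mspace m1 \<Longrightarrow> y \<in> mspace m1 \<Longrightarrow>
            mdist m2 (f x) (f y) \<le> Lip_const m1 m2 f * mdist m1 x y"
proof -
  define S where "S = {L. 0 \<le> L \<and>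
    (\<forall>x\<in>mspace m1. \<forall>y\<in>mspace m1. mdist m2 (f x) (f y) \<le> L * mdist m1 x y)}"
  have Lip: "Lip_const m1 m2 f = Inf S" by (simp add: Lip_const_def S_def)
  obtain B where B: "\<forall>x\<in>mspace m1. \<forall>y\<in>mspace m1. mdist m2 (f x) (f y) \<le> B * mdist m1 x y"
    using assms by (auto simp: Lipschitz_continuous_map_def)
  have "B * mdist m1 x y \<le> max B 0 * mdist m1 x y" for x y
    by (rule mult_right_mono) auto
  with B have "max B 0 \<in> S"
    unfolding S_def by (simp, meson order_trans)
  then have ne: "S \<noteq> {}" by blast
  show "0 \<le> Lip_const m1 m2 f"
    unfolding Lip using ne by (rule cInf_greatest) (auto simp: S_def)
  fix x y assume xy: "x \<in> mspace m1" "y \<in> mspace m1"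
  show "mdist m2 (f x) (f y) \<le> Lip_const m1 m2 f * mdist m1 x y"
  proof (cases "mdist m1 x y = 0")
    case True
    from B xy have "mdist m2 (f x) (f y) \<le> B * mdist m1 x y" by blast
    with True show ?thesis by simp
  next
    case False
    then have pos: "0 < mdist m1 x y"
      using mdist_nonneg[of m1 x y] by linarith
    have "mdist m2 (f x) (f y) / mdist m1 x y \<le> Inf S"
      using ne by (rule cInf_greatest) (use pos xy in \<open>auto simp: S_def pos_divide_le_eq\<close>)
    with pos show ?thesis by (simp add: Lip pos_divide_le_eq)
  qed
qed

text \<open>Multiplying \<open>f\<close> by the Lipschitz constant of its inverse makes it noncontracting, and its edges
  are then bounded by the distortion. Passing from \<open>norm\<close> to \<open>N\<close> costs the factor \<open>B / A\<close>.\<close>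

lemma bilipschitz_embedding_tree_embeds:
  fixes f :: "nat list \<Rightarrow> 'a::real_normed_vector" and N :: "'a \<Rightarrow> real"
  assumes f: "bilipschitz_embedding (tree_metric h) euclidean_metric f"
    and hom: "\<And>r x. N (r *\<^sub>R x) = \<bar>r\<bar> * N x"
    and eqv: "0 < A" "0 < B" "\<And>x. A * norm x \<le> N x" "\<And>x. N x \<le> B * norm x"
  shows "tree_embeds N h (B / A * distortion (tree_metric h) euclidean_metric f)"
proof -
  let ?T = "tree_vertices h"
  define m where "m = submetric (euclidean_metric :: 'a metric) (f ` ?T)"
  define L1 where "L1 = Lip_const (tree_metric h) euclidean_metric f"
  define L2 where "L2 = Lip_const m (tree_metric h) (inv_into ?T f)"
  have inj: "inj_on f ?T"
    and Lip1: "Lipschitz_continuous_map (tree_metric h) euclidean_metric f"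
    and Lip2: "Lipschitz_continuous_map m (tree_metric h) (inv_into ?T f)"
    using f by (auto simp: bilipschitz_embedding_def m_def)
  have L1: "norm (f u - f v) \<le> L1 * tree_dist h u v" if "u \<in> ?T" "v \<in> ?T" for u v
    using Lip_const_bound(2)[OF Lip1, of u v] that by (simp add: L1_def dist_norm)
  have L2: "tree_dist h u v \<le> L2 * norm (f u - f v)" if "u \<in> ?T" "v \<in> ?T" for u v
    using Lip_const_bound(2)[OF Lip2, of "f u" "f v"] that inj
    by (simp add: L2_def m_def dist_norm)
  have nn: "0 \<le> L1" "0 \<le> L2"
    unfolding L1_def L2_def by (intro Lip_const_bound(1)[OF Lip1] Lip_const_bound(1)[OF Lip2])+
  define g where "g u = (L2 / A) *\<^sub>R f u" for u
  have Ng: "N (g u - g v) = L2 / A * N (f u - f v)" for u v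
    unfolding g_def using hom[of "L2 / A"] nn eqv by (simp flip: scaleR_diff_right)
  have "real (prefix_dist u v) \<le> N (g u - g v)" if "u \<in> ?T" "v \<in> ?T" for u v
  proof -
    have "real (prefix_dist u v) \<le> L2 * norm (f u - f v)"
      using prefix_dist_le_tree_dist[OF that] L2[OF that] by linarith
    also have "\<dots> = L2 / A * (A * norm (f u - f v))"
      using eqv(1) by simp
    also have "\<dots> \<le> N (g u - g v)"
      unfolding Ng using nn eqv by (intro mult_left_mono) auto
    finally show ?thesis .
  qed
  moreover have "N (g u - g (u @ [k])) \<le> B / A * (L1 * L2)" if uk: "u @ [k] \<in> ?T" for u k
  proof -
    have "u \<in> ?T" using uk by (auto simp: tree_vertices_def)
    from L1[OF this uk] have "norm (f u - f (u @ [k])) \<le> L1 * tree_dist h u (u @ [k])" .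
    also have "\<dots> \<le> L1 * 1"
      using tree_dist_snoc_le[OF uk] nn by (intro mult_left_mono) auto
    finally have "B * norm (f u - f (u @ [k])) \<le> B * L1"
      using eqv(2) by simp
    with eqv(4) have "N (f u - f (u @ [k])) \<le> B * L1"
      by (rule order_trans)
    then have "L2 / A * N (f u - f (u @ [k])) \<le> L2 / A * (B * L1)"
      using nn eqv(1) by (intro mult_left_mono) auto
    then show ?thesis by (simp add: Ng mult_ac)
  qed
  moreover have "distortion (tree_metric h) euclidean_metric f = L1 * L2"
    by (simp add: distortion_def L1_def L2_def m_def)
  ultimately show ?thesis unfolding tree_embeds_def by auto
qed


section \<open>Distortion of the countably branching trees\<close>

text \<open>For a target distortion \<open>R\<close> fix the corresponding \<open>D\<close> and its gain \<open>c\<close>; every \<open>k\<close> with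
  \<open>k * c > D\<close> then rules out distortion below \<open>R\<close> at height \<open>2 ^ k\<close>.\<close>

lemma SUP_least_distortion_tree:
  fixes N :: "'a::banach \<Rightarrow> real"
  assumes "equivalent_norm N" "property_beta N"
  shows "(SUP h\<in>{1..}. least_distortion (euclidean_metric :: 'a metric) (tree_metric h)) = \<infinity>"
proof -
  from assms(1) obtain A B where hom: "\<And>r x. N (r *\<^sub>R x) = \<bar>r\<bar> * N x"
    and eqv: "0 < A" "0 < B" "\<And>x. A * norm x \<le> N x" "\<And>x. N x \<le> B * norm x"
    unfolding equivalent_norm_def by metis
  have "\<exists>h\<in>{1..}. ereal (real R) \<le> least_distortion (euclidean_metric :: 'a metric) (tree_metric h)"
    for R :: nat
  proof -
    \<comment> \<open>The summand \<open>1\<close> only keeps \<open>D\<close> positive when \<open>R = 0\<close>.\<close>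
    define D where "D = B / A * (real R + 1)"
    have "0 < D" using eqv by (simp add: D_def add_nonneg_pos)
    then obtain c where "0 < c" and c: "\<And>s. 1 \<le> s \<Longrightarrow> s \<le> D \<Longrightarrow> fork_contracting N s c"
      using property_beta_fork_contracting[OF hom assms(2)] by metis
    obtain k where k: "D < real k * c"
      using \<open>0 < c\<close> ex_less_of_nat_mult by blast
    have "ereal (real R) \<le> ereal (distortion (tree_metric (2 ^ k)) euclidean_metric f)"
      if f: "bilipschitz_embedding (tree_metric (2 ^ k)) (euclidean_metric :: 'a metric) f" for f
    proof (rule ccontr)
      assume "\<not> ?thesis"
      then have "B / A * distortion (tree_metric (2 ^ k)) euclidean_metric f \<le> D"
        unfolding D_def using eqv by (intro mult_left_mono) auto
      then have "tree_embeds N (2 ^ k) D"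
        using tree_embeds_mono[OF bilipschitz_embedding_tree_embeds[OF f hom eqv]] by blast
      then have "1 + real k * c \<le> D"
        using tree_embeds_pow2_bound[OF hom _ _ c] \<open>0 < c\<close> by simp
      with k show False by simp
    qed
    then have "ereal (real R) \<le> least_distortion (euclidean_metric :: 'a metric) (tree_metric (2 ^ k))"
      unfolding least_distortion_def by (intro INF_greatest) auto
    then show ?thesis by (intro bexI[of _ "2 ^ k"]) auto
  qed
  then show ?thesis
    by (intro SUP_PInfty) auto
qed

text \<open>The tree of height \<open>h\<close> contains the one of height \<open>2 ^ k\<close> for the largest admissible \<open>k\<close>, to which
  the iterated bound applies with every \<open>\<gamma>' < \<gamma>\<close>.\<close>

lemma least_distortion_tree_ge:
  assumes beta: "property_beta_p (norm :: 'a::banach \<Rightarrow> real) p \<gamma>" and "1 < p" "2 \<le> h"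
  shows "ereal (2 * \<gamma> powr (1 / p) * ln (real h / 2) powr (1 / p))
           \<le> least_distortion (euclidean_metric :: 'a metric) (tree_metric h)"
proof -
  have "0 < \<gamma>" using beta by (simp add: property_beta_p_def)
  obtain k :: nat where k: "2 ^ k \<le> h" "h < 2 ^ (k + 1)"
    using ex_power_ivl1[of 2 h] \<open>2 \<le> h\<close> by auto
  have "ln (real h / 2) \<le> ln (2 ^ k)"
  proof -
    have "real h < 2 * 2 ^ k"
      using k(2) by (metis power_Suc Suc_eq_plus1 of_nat_less_iff of_nat_numeral of_nat_power)
    then show ?thesis using \<open>2 \<le> h\<close> by simp
  qed
  also have "\<dots> = real k * ln 2" by (simp add: ln_realpow)
  also have "\<dots> \<le> real k"
    using ln_2_less_1 by (simp add: mult_left_le)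
  finally have lnk: "ln (real h / 2) \<le> real k" .
  have ln0: "0 \<le> ln (real h / 2)" using \<open>2 \<le> h\<close> by simp
  have "2 * \<gamma> powr (1 / p) * ln (real h / 2) powr (1 / p)
           \<le> distortion (tree_metric h) euclidean_metric f"
    if f: "bilipschitz_embedding (tree_metric h) (euclidean_metric :: 'a metric) f" for f
  proof -
    define D where "D = distortion (tree_metric h) euclidean_metric f"
    have "tree_embeds (norm :: 'a \<Rightarrow> real) h (1 / 1 * D)"
      unfolding D_def by (rule bilipschitz_embedding_tree_embeds[OF f]) auto
    then have emb: "tree_embeds (norm :: 'a \<Rightarrow> real) (2 ^ k) D"
      using tree_embeds_mono k(1) by fastforce
    then have "1 \<le> D" using tree_embeds_ge_1 by fastforce
    have *: "real k * 2 powr p * \<gamma>' \<le> D powr p" if "\<gamma>' \<in> {0<..<\<gamma>}" for \<gamma>'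
    proof -
      let ?c = "\<gamma>' * 2 powr p * D powr (1 - p)"
      have "1 + real k * ?c \<le> D"
        using that emb \<open>1 < p\<close>
        by (intro tree_embeds_pow2_bound[where N = "norm :: 'a \<Rightarrow> real"]
            property_beta_p_fork_contracting[OF beta]) auto
      \<comment> \<open>Multiplication by \<open>D powr (p - 1)\<close> cancels the power of \<open>D\<close> in the gain.\<close>
      then have "real k * ?c * D powr (p - 1) \<le> D * D powr (p - 1)"
        by (intro mult_right_mono) auto
      also have "D * D powr (p - 1) = D powr p"
        using \<open>1 \<le> D\<close> by (simp add: powr_diff)
      also have "real k * ?c * D powr (p - 1) =
                   real k * 2 powr p * \<gamma>' * (D powr (1 - p) * D powr (p - 1))"
        by (simp only: mult_ac)
      also have "D powr (1 - p) * D powr (p - 1) = 1"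
        using \<open>1 \<le> D\<close> by (simp flip: powr_add)
      finally show ?thesis by simp
    qed
    have "((\<lambda>g. real k * 2 powr p * g) \<longlongrightarrow> real k * 2 powr p * \<gamma>) (at_left \<gamma>)"
      by (intro tendsto_intros)
    then have "real k * 2 powr p * \<gamma> \<le> D powr p"
      by (rule tendsto_upperbound)
        (use * eventually_at_left_real[OF \<open>0 < \<gamma>\<close>] in \<open>auto elim: eventually_mono\<close>)
    moreover have "ln (real h / 2) * 2 powr p * \<gamma> \<le> real k * 2 powr p * \<gamma>"
      using lnk \<open>0 < \<gamma>\<close> by (intro mult_right_mono) auto
    ultimately have "ln (real h / 2) * 2 powr p * \<gamma> \<le> D powr p" by (rule order_trans[rotated])
    then have "(ln (real h / 2) * 2 powr p * \<gamma>) powr (1 / p) \<le> (D powr p) powr (1 / p)"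
      using \<open>0 < \<gamma>\<close> ln0 \<open>1 < p\<close> by (intro powr_mono2) auto
    then show ?thesis
      using \<open>0 < \<gamma>\<close> ln0 \<open>1 < p\<close> \<open>1 \<le> D\<close>
      by (simp add: powr_mult powr_powr mult_ac flip: D_def)
  qed
  then show ?thesis
    unfolding least_distortion_def by (intro INF_greatest) auto
qed

theorem theorem2p1:
  shows "((\<exists>N :: 'a::banach \<Rightarrow> real. equivalent_norm N \<and> property_beta N) \<longrightarrow>
            (SUP h\<in>{1..}. least_distortion (euclidean_metric :: 'a metric) (tree_metric h)) = \<infinity>) \<and>
         (\<forall>p \<gamma> :: real. 1 < p \<and> property_beta_p (norm :: 'a \<Rightarrow> real) p \<gamma> \<longrightarrow>
            (\<forall>h::nat. 2 \<le> h \<longrightarrow>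
               ereal (2 * \<gamma> powr (1 / p) * ln (real h / 2) powr (1 / p))
                 \<le> least_distortion (euclidean_metric :: 'a metric) (tree_metric h)))"
  using SUP_least_distortion_tree least_distortion_tree_ge by blast

end
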